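(* Let $\epsilon\in(0,1]$ be fixed (and known), let $\alpha\in\left[\frac{1+\epsilon}{1+2\epsilon},1\right)$, $q\in\left[0,\frac{\epsilon}{1+2\epsilon}\right]$ and $\beta_\alpha=\frac{(1-\alpha)(1+\epsilon)}{\epsilon}$. For every $K\ge2$, every $u>0$ and every fixed instance $\underline\nu\in\mathcal H_{\epsilon,u}$, the algorithm AdaR-ETC run with parameters $(\alpha,q)$ (defined in the context; it does not use $u$) satisfies $$\limsup_{T\to+\infty}\frac{R_T(\underline\nu)}{K^{q-1}T^{\beta_\alpha}}\ \le\ \sum_{i:\Delta_i>0}\Delta_i .$$
   Context: Bandit model. There are $K\ge 2$ arms and a horizon of $T\ge1$ rounds. An instance is a tuple $\underline\nu=(\nu_1,\dots,\nu_K)$ of probability distributions on $\mathbb R$. Successive pulls of arm $i$ produce i.i.d. rewards from $\nu_i$, independently across arms. At each round $t$ the learner picks an arm $I_t\in\{1,\dots,K\}$ based on the past and observes a reward of that arm. For $\epsilon\in(0,1]$, $u>0$, $$\mathcal H_{\epsilon,u}=\{(\nu_1,\dots,\nu_K):\ \mathbb E_{X\sim\nu_i}[|X|^{1+\epsilon}]\le u\ \text{ for all } i\}.$$ With $\mu_i=\mathbb E_{X\sim\nu_i}[X]$, $\mu^*=\max_i\mu_i$, $\Delta_i=\mu^*-\mu_i$, the expected regret is $R_T(\underline\nu)=\mathbb E\big[\sum_{t=1}^T(\mu^*-\mu_{I_t})\big]$. Algorithm AdaR-ETC (Median-of-Means explore-then-commit). Inputs: $K,T,\epsilon,\alpha,q$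 (for each horizon $T$ the algorithm is run with that $T$). Set $$\beta_\alpha=\frac{(1-\alpha)(1+\epsilon)}{\epsilon},\quad B_T=\lceil 8\log(KT^3)\rceil,\quad \widetilde L_T=KB_T+\lceil K^qT^{\beta_\alpha}\rceil,\quad L_T=\min\{T,\widetilde L_T\}.$$ Exploration: for $t=1,\dots,L_T$ play $I_t=1+((t-1)\bmod K)$. Commitment: if $L_T<T$, compute for each arm $i$ the Median-of-Means estimate $\widehat\mu_i^{MoM}$ from its $n_i$ exploration samples, choose $\widehat I^*\in\arg\max_i\widehat\mu_i^{MoM}$, and play $I_t=\widehat I^*$ for $t=L_T+1,\dots,T$. Median-of-Means estimate: given samples $X_{i,1},\dots,X_{i,n_i}$, let $s_i=\lfloor n_i/B_T\rfloor$, form the $B_T$ block averages $\overline X_{i,b}=\frac1{s_i}\sum_{\ell=(b-1)s_i+1}^{bs_i}X_{i,\ell}$, $b=1,\dots,B_T$ (leftover samples are discarded), and let $\widehat\mu_i^{MoM}$ be the $\lceil B_T/2\rceil$-th smallest block average. *)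

theory Defs
  imports "HOL-Probability.Probability"
begin

section \<open>Stochastic bandits\<close>

text \<open>
  Arms are the numbers \<open>1, \<dots>, K\<close>; an instance is a function \<open>\<nu>\<close> from arms to measures
  on the reals, of which only the values on \<open>{1..K}\<close> matter.  The moment is a nonnegative
  integral, because the Bochner integral of a non-integrable function is 0.
\<close>

definition bounded_moment_class :: "nat \<Rightarrow> real \<Rightarrow> real \<Rightarrow> (nat \<Rightarrow> real measure) set" where
  "bounded_moment_class K \<epsilon> u =
     {\<nu>. \<forall>i\<in>{1..K}. prob_space (\<nu> i) \<and> sets (\<nu> i) = sets borel \<and>
          (\<integral>\<^sup>+x. ennreal (\<bar>x\<bar> powr (1 + \<epsilon>)) \<partial>\<nu> i) \<le> ennreal u}"

definition arm_mean :: "(nat \<Rightarrow> real measure) \<Rightarrow> nat \<Rightarrow> real" where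
  "arm_mean \<nu> i = (\<integral>x. x \<partial>\<nu> i)"

definition best_mean :: "nat \<Rightarrow> (nat \<Rightarrow> real measure) \<Rightarrow> real" where
  "best_mean K \<nu> = Max (arm_mean \<nu> ` {1..K})"

definition gap :: "nat \<Rightarrow> (nat \<Rightarrow> real measure) \<Rightarrow> nat \<Rightarrow> real" where
  "gap K \<nu> i = best_mean K \<nu> - arm_mean \<nu> i"

text \<open>\<open>X i l\<close> is the reward of the \<open>l\<close>-th pull of arm \<open>i\<close>, counting pulls from 1.\<close>

definition bandit_rewards ::
    "'w measure \<Rightarrow> nat \<Rightarrow> (nat \<Rightarrow> real measure) \<Rightarrow> (nat \<Rightarrow> nat \<Rightarrow> 'w \<Rightarrow> real) \<Rightarrow> bool" where
  "bandit_rewards M K \<nu> X \<longleftrightarrow>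
     prob_space M \<and>
     prob_space.indep_vars M (\<lambda>_. borel) (\<lambda>(i, l). X i l) ({1..K} \<times> {1..}) \<and>
     (\<forall>i\<in>{1..K}. \<forall>l\<ge>1. distr M borel (X i l) = \<nu> i)"

definition regret ::
    "'w measure \<Rightarrow> nat \<Rightarrow> (nat \<Rightarrow> real measure) \<Rightarrow> nat \<Rightarrow> (nat \<Rightarrow> 'w \<Rightarrow> nat) \<Rightarrow> real" where
  "regret M K \<nu> T I =
     (\<integral>\<omega>. (\<Sum>t=1..T. best_mean K \<nu> - arm_mean \<nu> (I t \<omega>)) \<partial>M)"


section \<open>Median of means\<close>

definition block_average :: "nat \<Rightarrow> (nat \<Rightarrow> real) \<Rightarrow> nat \<Rightarrow> real" where
  "block_average s x b = (\<Sum>l = (b - 1) * s + 1..b * s. x l) / real s"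

text \<open>
  \<open>B\<close> blocks, \<open>n\<close> samples \<open>x 1, \<dots>, x n\<close>.  List positions start at 0, so the
  \<open>k\<close>-th smallest value sits at position \<open>k - 1\<close> of the sorted list.
\<close>

definition median_of_means :: "nat \<Rightarrow> nat \<Rightarrow> (nat \<Rightarrow> real) \<Rightarrow> real" where
  "median_of_means B n x =
     sort (map (block_average (n div B) x) [1..<B + 1]) ! (nat \<lceil>real B / 2\<rceil> - 1)"


section \<open>The algorithm AdaR-ETC\<close>

definition adar_beta :: "real \<Rightarrow> real \<Rightarrow> real" where
  "adar_beta \<epsilon> \<alpha> = (1 - \<alpha>) * (1 + \<epsilon>) / \<epsilon>"

definition num_blocks :: "nat \<Rightarrow> nat \<Rightarrow> nat" where
  "num_blocks K T = nat \<lceil>8 * ln (real K * real T ^ 3)\<rceil>"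

definition exploration_length :: "nat \<Rightarrow> nat \<Rightarrow> real \<Rightarrow> real \<Rightarrow> real \<Rightarrow> nat" where
  "exploration_length K T \<epsilon> \<alpha> q =
     min T (K * num_blocks K T + nat \<lceil>real K powr q * real T powr adar_beta \<epsilon> \<alpha>\<rceil>)"

definition round_robin :: "nat \<Rightarrow> nat \<Rightarrow> nat" where
  "round_robin K t = 1 + (t - 1) mod K"

definition num_pulls :: "nat \<Rightarrow> nat \<Rightarrow> nat \<Rightarrow> nat" where
  "num_pulls K L i = card {t \<in> {1..L}. round_robin K t = i}"

text \<open>
  \<open>I t\<close> is the arm played in round \<open>t\<close> of a run with horizon \<open>T\<close>.  Ties in the
  maximisation may be broken in any measurable way, possibly at random, which is why
  this is a relation and not a function of the rewards.
\<close>

definition adar_etc_run ::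
    "'w measure \<Rightarrow> (nat \<Rightarrow> nat \<Rightarrow> 'w \<Rightarrow> real) \<Rightarrow> nat \<Rightarrow> nat \<Rightarrow> real \<Rightarrow> real \<Rightarrow> real
       \<Rightarrow> (nat \<Rightarrow> 'w \<Rightarrow> nat) \<Rightarrow> bool" where
  "adar_etc_run M X K T \<epsilon> \<alpha> q I \<longleftrightarrow>
     (let L = exploration_length K T \<epsilon> \<alpha> q;
          est = (\<lambda>\<omega> i. median_of_means (num_blocks K T) (num_pulls K L i) (\<lambda>l. X i l \<omega>))
      in (\<forall>t\<in>{1..T}. I t \<in> measurable M (count_space UNIV)) \<and>
         (\<forall>\<omega>\<in>space M. \<forall>t\<in>{1..L}. I t \<omega> = round_robin K t) \<and>
         (L < T \<longrightarrow>
            (\<forall>\<omega>\<in>space M. \<exists>c. is_arg_max (est \<omega>) (\<lambda>i. i \<in> {1..K}) c \<and>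
                               (\<forall>t\<in>{L + 1..T}. I t \<omega> = c))))"

end

theory Submission
  imports Defs "HOL-Real_Asymp.Real_Asymp"
begin

text \<open>For a fixed instance no sharp deviation inequality is needed.  Since \<open>\<beta> > 0\<close>, the block length
  tends to infinity, so by the weak law of large numbers each single block average is off by half the
  smallest gap with probability at most \<open>exp (- 4)\<close>.  The median is off only if at least half of the
  \<open>B\<close> independent blocks are; summing over the at most \<open>2 ^ B\<close> sets of blocks bounds this by
  \<open>2 ^ B * exp (- 2 * B) \<le> exp (- B)\<close>, and \<open>B \<ge> 8 * ln (K * T ^ 3)\<close> makes the expected
  commitment regret bounded.  The exploration regret is at most \<open>L / K + 1\<close> times the sum of the
  gaps, and \<open>L / K\<close> is \<open>K powr (q - 1) * T powr \<beta>\<close> up to a logarithmic term.\<close>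

subsection \<open>A uniform weak law of large numbers\<close>

text \<open>Dominated convergence with dominating function \<open>\<bar>x\<bar>\<close>: at each
  fixed \<open>x\<close> the integrand vanishes as soon as the cutoff reaches
  \<open>\<bar>x\<bar>\<close>. Only the first moment enters, so no rate in \<open>C\<close> comes
  out.\<close>

lemma truncation_tail_small:
  fixes N :: "real measure"
  assumes sets: "sets N = sets borel" and int: "integrable N (\<lambda>x. x)" and "\<eta> > 0"
  obtains C :: real where "C > 0" "(\<integral>x. \<bar>if \<bar>x\<bar> \<le> C then 0 else x\<bar> \<partial>N) < \<eta>"
proof -
  note [measurable_cong] = sets
  have "(\<lambda>n. \<integral>x. \<bar>if \<bar>x\<bar> \<le> real n then 0 else x\<bar> \<partial>N) \<longlonglongrightarrow> (\<integral>x. 0 \<partial>N)"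
  proof (rule integral_dominated_convergence[where w = "\<lambda>x. \<bar>x\<bar>"])
    show "AE x in N. (\<lambda>n. \<bar>if \<bar>x\<bar> \<le> real n then 0 else x\<bar>) \<longlonglongrightarrow> 0"
    proof (rule always_eventually, rule allI, rule tendsto_eventually)
      fix x :: real
      obtain n where "\<bar>x\<bar> \<le> real n"
        using real_arch_simple by blast
      then show "\<forall>\<^sub>F n in sequentially. \<bar>if \<bar>x\<bar> \<le> real n then 0 else x\<bar> = 0"
        by (intro eventually_sequentiallyI[of n]) auto
    qed
    show "integrable N (\<lambda>x. \<bar>x\<bar>)"
      using int by (rule integrable_abs)
    show "AE x in N. norm \<bar>if \<bar>x\<bar> \<le> real n then 0 else x\<bar> \<le> \<bar>x\<bar>" for n
      by (intro always_eventually) simp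
  qed measurable
  then have "eventually (\<lambda>n. (\<integral>x. \<bar>if \<bar>x\<bar> \<le> real n then 0 else x\<bar> \<partial>N) < \<eta>) sequentially"
    using \<open>\<eta> > 0\<close> by (intro order_tendstoD(2)) auto
  \<comment> \<open>A positive cutoff is wanted because \<open>\<delta>\<close> is later divided by
    \<open>C\<close>.\<close>
  moreover have "eventually (\<lambda>n::nat. n > 0) sequentially"
    by (rule eventually_gt_at_top)
  ultimately have "eventually (\<lambda>n. real n > 0 \<and> (\<integral>x. \<bar>if \<bar>x\<bar> \<le> real n then 0 else x\<bar> \<partial>N) < \<eta>) sequentially"
    by eventually_elim auto
  then obtain n where "real n > 0" "(\<integral>x. \<bar>if \<bar>x\<bar> \<le> real n then 0 else x\<bar> \<partial>N) < \<eta>"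
    by (auto simp: eventually_sequentially)
  then show thesis
    by (rule that)
qed

text \<open>Each sample is split into a part bounded by \<open>C\<close> and a remainder. The
  deviation then has three sources, each allotted \<open>\<delta> / 3\<close>: the fluctuation of
  the bounded parts (Hoeffding, first term of the bound), the remainders (Markov, second term), and
  the deterministic bias that truncation causes in the mean, which is at most
  \<open>\<zeta>\<close>.\<close>

lemma (in prob_space) sample_mean_deviation_truncated:
  fixes X :: "'i \<Rightarrow> 'a \<Rightarrow> real" and N :: "real measure"
  assumes N: "sets N = sets borel" "integrable N (\<lambda>x. x)"
    and A: "finite A" "A \<noteq> {}"
    and indep: "indep_vars (\<lambda>_. borel) X A"
    and distr: "\<And>l. l \<in> A \<Longrightarrow> distr M borel (X l) = N"
    and "C > 0" "\<delta> > 0"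
    and tail: "(\<integral>x. \<bar>if \<bar>x\<bar> \<le> C then 0 else x\<bar> \<partial>N) \<le> \<zeta>" "\<zeta> \<le> \<delta> / 3"
  shows "prob {\<omega>\<in>space M. \<bar>(\<Sum>l\<in>A. X l \<omega>) / card A - (\<integral>x. x \<partial>N)\<bar> \<ge> \<delta>}
           \<le> 2 * exp (- (real (card A) * (\<delta> / C)\<^sup>2 / 18)) + 3 * \<zeta> / \<delta>"
proof -
  define s where "s = real (card A)"
  have s: "s > 0"
    using A by (simp add: s_def card_gt_0_iff)
  define Y where "Y = (\<lambda>x::real. if \<bar>x\<bar> \<le> C then x else 0)"
  define Z where "Z = (\<lambda>x::real. if \<bar>x\<bar> \<le> C then 0 else x)"
  have YZ: "x = Y x + Z x" for x
    by (simp add: Y_def Z_def)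
  have [measurable]: "Y \<in> borel_measurable borel" "Z \<in> borel_measurable borel"
    by (simp_all add: Y_def Z_def)
  have rv: "random_variable borel (X l)" if "l \<in> A" for l
    using indep that by (auto simp: indep_vars_def2)
  note [measurable_cong] = N(1)
  have intZ: "integrable N Z" and intZ': "integrable N (\<lambda>x. \<bar>Z x\<bar>)"
    by (rule Bochner_Integration.integrable_bound[OF N(2)]; auto simp: Z_def)+
  have intY: "integrable N Y"
    by (rule Bochner_Integration.integrable_bound[OF N(2)]) (auto simp: Y_def)
  have ZX: "integrable M (\<lambda>\<omega>. \<bar>Z (X l \<omega>)\<bar>)" "expectation (\<lambda>\<omega>. \<bar>Z (X l \<omega>)\<bar>) = (\<integral>x. \<bar>Z x\<bar> \<partial>N)"
    "expectation (\<lambda>\<omega>. Y (X l \<omega>)) = (\<integral>x. Y x \<partial>N)"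
    if "l \<in> A" for l
  proof -
    note [measurable] = rv[OF that]
    show "integrable M (\<lambda>\<omega>. \<bar>Z (X l \<omega>)\<bar>)"
      using intZ' unfolding distr[OF that, symmetric] by (subst (asm) integrable_distr_eq) auto
    show "expectation (\<lambda>\<omega>. \<bar>Z (X l \<omega>)\<bar>) = (\<integral>x. \<bar>Z x\<bar> \<partial>N)"
      unfolding distr[OF that, symmetric] by (subst integral_distr) auto
    show "expectation (\<lambda>\<omega>. Y (X l \<omega>)) = (\<integral>x. Y x \<partial>N)"
      unfolding distr[OF that, symmetric] by (subst integral_distr) auto
  qed
  interpret H: Hoeffding_ineq M A "\<lambda>l \<omega>. Y (X l \<omega>)" "\<lambda>_. - C" "\<lambda>_. C"
    "\<Sum>l\<in>A. expectation (\<lambda>\<omega>. Y (X l \<omega>))"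
  proof (unfold_locales)
    show "indep_vars (\<lambda>_. borel) (\<lambda>l \<omega>. Y (X l \<omega>)) A"
      by (rule indep_vars_compose2[OF indep]) auto
  qed (use A \<open>C > 0\<close> in \<open>auto simp: Y_def\<close>)
  have var: "(\<Sum>l\<in>A. (C - - C)\<^sup>2) = s * (4 * C\<^sup>2)"
    by (simp add: s_def power2_eq_square)
  \<comment> \<open>Hoeffding's exponent for deviation \<open>s * (\<delta> / 3)\<close> and ranges
    of length \<open>2 * C\<close>; the constant 18 is 9 * 4 / 2.\<close>
  have expo: "- 2 * (s * (\<delta> / 3))\<^sup>2 / (s * (4 * C\<^sup>2)) = - (s * (\<delta> / C)\<^sup>2 / 18)"
    using s \<open>C > 0\<close> by (simp add: power2_eq_square mult_ac)
  have centre: "(\<Sum>l\<in>A. expectation (\<lambda>\<omega>. Y (X l \<omega>))) = s * (\<integral>x. Y x \<partial>N)"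
    by (simp add: ZX s_def)
  have hoeff: "prob {\<omega>\<in>space M. \<bar>(\<Sum>l\<in>A. Y (X l \<omega>)) - s * (\<integral>x. Y x \<partial>N)\<bar> \<ge> s * (\<delta> / 3)}
      \<le> 2 * exp (- (s * (\<delta> / C)\<^sup>2 / 18))"
    using H.Hoeffding_ineq_abs_ge[of "s * (\<delta> / 3)"] s \<open>\<delta> > 0\<close> \<open>C > 0\<close>
    unfolding var expo centre by simp
  \<comment> \<open>The sample size cancels in Markov's bound, so this term becomes small through
    the choice of \<open>C\<close> and not through averaging.\<close>
  have "prob {\<omega>\<in>space M. s * (\<delta> / 3) \<le> (\<Sum>l\<in>A. \<bar>Z (X l \<omega>)\<bar>)}
      \<le> expectation (\<lambda>\<omega>. \<Sum>l\<in>A. \<bar>Z (X l \<omega>)\<bar>) / (s * (\<delta> / 3))"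
    using s \<open>\<delta> > 0\<close> ZX
    by (intro integral_Markov_inequality_measure[where A = "space M"]) (auto intro!: sum_nonneg)
  also have "\<dots> = (\<integral>x. \<bar>Z x\<bar> \<partial>N) * 3 / \<delta>"
    using s by (simp add: ZX Bochner_Integration.integral_sum flip: s_def)
  also have "\<dots> \<le> 3 * \<zeta> / \<delta>"
    using tail(1) \<open>\<delta> > 0\<close> by (simp add: Z_def divide_right_mono)
  finally have markov: "prob {\<omega>\<in>space M. s * (\<delta> / 3) \<le> (\<Sum>l\<in>A. \<bar>Z (X l \<omega>)\<bar>)} \<le> 3 * \<zeta> / \<delta>" .
  have mean: "\<bar>(\<integral>x. Y x \<partial>N) - (\<integral>x. x \<partial>N)\<bar> \<le> \<delta> / 3"
  proof -
    have "(\<integral>x. x \<partial>N) = (\<integral>x. Y x + Z x \<partial>N)"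
      by (simp flip: YZ)
    also have "\<dots> = (\<integral>x. Y x \<partial>N) + (\<integral>x. Z x \<partial>N)"
      using intY intZ by (rule Bochner_Integration.integral_add)
    finally have "\<bar>(\<integral>x. Y x \<partial>N) - (\<integral>x. x \<partial>N)\<bar> = \<bar>\<integral>x. Z x \<partial>N\<bar>"
      by simp
    also have "\<dots> \<le> (\<integral>x. \<bar>Z x\<bar> \<partial>N)"
      by (rule integral_abs_bound)
    finally show ?thesis
      using tail by (simp add: Z_def)
  qed
  have [measurable]: "random_variable borel (\<lambda>\<omega>. \<Sum>l\<in>A. f (X l \<omega>))"
    if "f \<in> borel_measurable borel" for f :: "real \<Rightarrow> real"
    by (rule borel_measurable_sum) (use rv that in \<open>auto intro: measurable_compose\<close>)
  let ?A = "{\<omega>\<in>space M. \<bar>(\<Sum>l\<in>A. Y (X l \<omega>)) - s * (\<integral>x. Y x \<partial>N)\<bar> \<ge> s * (\<delta> / 3)}"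
  let ?B = "{\<omega>\<in>space M. s * (\<delta> / 3) \<le> (\<Sum>l\<in>A. \<bar>Z (X l \<omega>)\<bar>)}"
  have [measurable]: "random_variable borel (\<lambda>\<omega>. \<Sum>l\<in>A. Y (X l \<omega>))"
    "random_variable borel (\<lambda>\<omega>. \<Sum>l\<in>A. \<bar>Z (X l \<omega>)\<bar>)"
    by measurable
  \<comment> \<open>Outside both events two of the errors are strictly below
    \<open>s * (\<delta> / 3)\<close> and the bias is at most that, so the total stays strictly
    below \<open>s * \<delta>\<close>.\<close>
  have "{\<omega>\<in>space M. \<bar>(\<Sum>l\<in>A. X l \<omega>) / card A - (\<integral>x. x \<partial>N)\<bar> \<ge> \<delta>} \<subseteq> ?A \<union> ?B"
  proof (rule subsetI, rule ccontr)
    fix \<omega> assume \<omega>: "\<omega> \<in> {\<omega>\<in>space M. \<bar>(\<Sum>l\<in>A. X l \<omega>) / card A - (\<integral>x. x \<partial>N)\<bar> \<ge> \<delta>}"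
      and not: "\<omega> \<notin> ?A \<union> ?B"
    have 1: "\<bar>(\<Sum>l\<in>A. Y (X l \<omega>)) - s * (\<integral>x. Y x \<partial>N)\<bar> < s * (\<delta> / 3)"
      and 2: "(\<Sum>l\<in>A. \<bar>Z (X l \<omega>)\<bar>) < s * (\<delta> / 3)"
      using \<omega> not by auto
    have 3: "\<bar>\<Sum>l\<in>A. Z (X l \<omega>)\<bar> \<le> (\<Sum>l\<in>A. \<bar>Z (X l \<omega>)\<bar>)"
      by (rule sum_abs)
    have 4: "\<bar>s * (\<integral>x. Y x \<partial>N) - s * (\<integral>x. x \<partial>N)\<bar> \<le> s * (\<delta> / 3)"
      using mult_left_mono[OF mean, of s] s by (simp add: abs_mult flip: right_diff_distrib)
    have 5: "(\<Sum>l\<in>A. X l \<omega>) = (\<Sum>l\<in>A. Y (X l \<omega>)) + (\<Sum>l\<in>A. Z (X l \<omega>))"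
      by (simp flip: sum.distrib YZ)
    have "\<bar>(\<Sum>l\<in>A. X l \<omega>) - s * (\<integral>x. x \<partial>N)\<bar> < s * \<delta>"
      using 1 2 3 4 unfolding 5 abs_less_iff abs_le_iff by linarith
    moreover have "\<bar>(\<Sum>l\<in>A. X l \<omega>) - s * (\<integral>x. x \<partial>N)\<bar> =
        s * \<bar>(\<Sum>l\<in>A. X l \<omega>) / s - (\<integral>x. x \<partial>N)\<bar>"
    proof -
      have "(\<Sum>l\<in>A. X l \<omega>) - s * (\<integral>x. x \<partial>N) = s * ((\<Sum>l\<in>A. X l \<omega>) / s - (\<integral>x. x \<partial>N))"
        using s by (simp add: right_diff_distrib)
      then show ?thesis
        using s by (simp add: abs_mult)
    qed
    ultimately show False
      using \<omega> s by (simp add: s_def)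
  qed
  then have "prob {\<omega>\<in>space M. \<bar>(\<Sum>l\<in>A. X l \<omega>) / card A - (\<integral>x. x \<partial>N)\<bar> \<ge> \<delta>} \<le> prob (?A \<union> ?B)"
    by (rule finite_measure_mono) measurable
  also have "\<dots> \<le> prob ?A + prob ?B"
    by (rule measure_Un_le) measurable
  finally show ?thesis
    using hoeff markov by (simp flip: s_def)
qed

text \<open>The threshold \<open>s\<close> depends on the common distribution alone, so that one \<open>s\<close> serves every block
  of every horizon.\<close>

lemma (in prob_space) weak_law_uniform:
  fixes N :: "real measure"
  assumes N: "sets N = sets borel" "integrable N (\<lambda>x. x)"
    and "\<delta> > 0" "\<eta> > 0"
  obtains s :: nat where
    "\<And>(A :: 'i set) X. finite A \<Longrightarrow> s \<le> card A \<Longrightarrow> indep_vars (\<lambda>_. borel) X A \<Longrightarrow>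
       (\<And>l. l \<in> A \<Longrightarrow> distr M borel (X l) = N) \<Longrightarrow>
       prob {\<omega>\<in>space M. \<bar>(\<Sum>l\<in>A. X l \<omega>) / card A - (\<integral>x. x \<partial>N)\<bar> \<ge> \<delta>} \<le> \<eta>"
proof -
  \<comment> \<open>The first entry covers the truncation bias, the second makes Markov's term at
    most \<open>\<eta> / 2\<close>. The other half of \<open>\<eta>\<close> is left to the Hoeffding
    term, which vanishes as the sample grows.\<close>
  define \<zeta> where "\<zeta> = min (\<delta> / 3) (\<delta> * \<eta> / 6)"
  have "\<zeta> > 0" "\<zeta> \<le> \<delta> / 3" "3 * \<zeta> / \<delta> \<le> \<eta> / 2"
    using \<open>\<delta> > 0\<close> \<open>\<eta> > 0\<close> by (auto simp: \<zeta>_def field_simps)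
  obtain C where C: "C > 0" "(\<integral>x. \<bar>if \<bar>x\<bar> \<le> C then 0 else x\<bar> \<partial>N) < \<zeta>"
    using truncation_tail_small[OF N \<open>\<zeta> > 0\<close>] by blast
  define c where "c = (\<delta> / C)\<^sup>2 / 18"
  have "c > 0"
    using \<open>\<delta> > 0\<close> C by (simp add: c_def)
  then have "(\<lambda>s::nat. 2 * exp (- (real s * c))) \<longlonglongrightarrow> 0"
    by real_asymp
  then have "eventually (\<lambda>s::nat. 2 * exp (- (real s * c)) < \<eta> / 2) sequentially"
    by (rule order_tendstoD(2)) (use \<open>\<eta> > 0\<close> in simp)
  then obtain s0 where s0: "\<And>s. s \<ge> s0 \<Longrightarrow> 2 * exp (- (real s * c)) < \<eta> / 2"
    by (auto simp: eventually_sequentially)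
  show thesis
  \<comment> \<open>The successor forces every admissible \<open>A\<close> to be nonempty.\<close>
  proof (rule that[of "Suc s0"])
    fix A :: "'i set" and X :: "'i \<Rightarrow> 'a \<Rightarrow> real"
    assume A: "finite A" "Suc s0 \<le> card A"
      and X: "indep_vars (\<lambda>_. borel) X A" "\<And>l. l \<in> A \<Longrightarrow> distr M borel (X l) = N"
    have "A \<noteq> {}"
      using A by auto
    from sample_mean_deviation_truncated[OF N A(1) this X C(1) \<open>\<delta> > 0\<close> less_imp_le[OF C(2)] \<open>\<zeta> \<le> \<delta> / 3\<close>]
    have "prob {\<omega>\<in>space M. \<bar>(\<Sum>l\<in>A. X l \<omega>) / card A - (\<integral>x. x \<partial>N)\<bar> \<ge> \<delta>}
        \<le> 2 * exp (- (real (card A) * c)) + 3 * \<zeta> / \<delta>"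
      by (simp add: c_def)
    also have "\<dots> \<le> \<eta>"
      using s0[of "card A"] A \<open>3 * \<zeta> / \<delta> \<le> \<eta> / 2\<close> by simp
    finally show "prob {\<omega>\<in>space M. \<bar>(\<Sum>l\<in>A. X l \<omega>) / card A - (\<integral>x. x \<partial>N)\<bar> \<ge> \<delta>} \<le> \<eta>" .
  qed
qed

subsection \<open>Concentration of the median of means\<close>

text \<open>Sorting keeps the multiset of values. Counting block indices instead of distinct values
  gives ties their multiplicity.\<close>

lemma length_filter_sort_map_interval:
  "length (filter P (sort (map f [1..<B + 1]))) = card {b\<in>{1..B}. P (f b)}"
proof -
  have "length (filter P (sort xs)) = length (filter P xs)" for xs
    by (metis mset_filter mset_sort size_mset)
  then have "length (filter P (sort (map f [1..<B + 1]))) = length (filter (\<lambda>b. P (f b)) [1..<B + 1])"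
    by (simp only: filter_map comp_def length_map)
  also have "\<dots> = card (set (filter (\<lambda>b. P (f b)) [1..<B + 1]))"
    by (subst distinct_card) auto
  also have "set (filter (\<lambda>b. P (f b)) [1..<B + 1]) = {b\<in>{1..B}. P (f b)}"
    by auto
  finally show ?thesis .
qed

text \<open>In the sorted list, positions \<open>0\<close> to \<open>j\<close> hold values at most
  the entry at \<open>j\<close>, and positions \<open>j\<close> to \<open>B - 1\<close> hold values
  at least that entry; both counts are then carried back to block indices.\<close>

lemma card_le_order_statistic:
  fixes f :: "nat \<Rightarrow> 'a :: linorder"
  assumes "j < B"
  shows "j + 1 \<le> card {b\<in>{1..B}. f b \<le> sort (map f [1..<B + 1]) ! j}" (is ?lower)
    and "B - j \<le> card {b\<in>{1..B}. f b \<ge> sort (map f [1..<B + 1]) ! j}" (is ?upper)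
proof -
  define ys where "ys = sort (map f [1..<B + 1])"
  have len: "length ys = B"
    by (simp add: ys_def)
  have mono: "i \<le> k \<Longrightarrow> k < B \<Longrightarrow> ys ! i \<le> ys ! k" for i k
    using len by (simp add: ys_def sorted_nth_mono)
  have "card {..j} \<le> card {i. i < length ys \<and> ys ! i \<le> ys ! j}"
    using assms len mono by (intro card_mono) auto
  then show ?lower
    using length_filter_sort_map_interval[of "\<lambda>y. y \<le> ys ! j" f B]
    by (simp only: length_filter_conv_card ys_def[symmetric] card_atMost card_atLeastLessThan Suc_eq_plus1)
  have "card {j..<B} \<le> card {i. i < length ys \<and> ys ! i \<ge> ys ! j}"
    using assms len mono by (intro card_mono) auto
  then show ?upper
    using length_filter_sort_map_interval[of "\<lambda>y. y \<ge> ys ! j" f B]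
    by (simp only: length_filter_conv_card ys_def[symmetric] card_atMost card_atLeastLessThan Suc_eq_plus1)
qed

text \<open>If the median is off on one side of \<open>\<mu>\<close>, every block average at or
  beyond it is off on the same side, and these are at least half of all blocks.\<close>

lemma median_of_means_deviation_imp_half_blocks:
  assumes "1 \<le> B" "\<bar>median_of_means B n x - \<mu>\<bar> \<ge> \<delta>"
  shows "B \<le> 2 * card {b\<in>{1..B}. \<bar>block_average (n div B) x b - \<mu>\<bar> \<ge> \<delta>}"
proof -
  define f where "f = block_average (n div B) x"
  define j where "j = nat \<lceil>real B / 2\<rceil> - 1"
  \<comment> \<open>\<open>j\<close> is the zero-based position of the median. For even
    \<open>B\<close> exactly half of the positions are at most \<open>j\<close> and one more than
    half are at least \<open>j\<close>; for odd \<open>B\<close> both counts are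
    \<open>(B + 1) / 2\<close>.\<close>
  have j: "j < B" "B \<le> 2 * (j + 1)" "B \<le> 2 * (B - j)"
  proof -
    have "\<lceil>real B / 2\<rceil> = int ((B + 1) div 2)"
      by (rule ceiling_unique; cases "even B") (auto elim!: evenE oddE)
    then have "j = (B + 1) div 2 - 1"
      unfolding j_def by simp
    then show "j < B" "B \<le> 2 * (j + 1)" "B \<le> 2 * (B - j)"
      using \<open>1 \<le> B\<close> by presburger+
  qed
  define m where "m = sort (map f [1..<B + 1]) ! j"
  have mom: "median_of_means B n x = m"
    by (simp add: median_of_means_def m_def j_def f_def)
  show ?thesis
  proof (cases "m \<le> \<mu>")
    case True
    then have "{b\<in>{1..B}. f b \<le> m} \<subseteq> {b\<in>{1..B}. \<bar>f b - \<mu>\<bar> \<ge> \<delta>}"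
      using assms(2) unfolding mom by auto
    then have "card {b\<in>{1..B}. f b \<le> m} \<le> card {b\<in>{1..B}. \<bar>f b - \<mu>\<bar> \<ge> \<delta>}"
      by (intro card_mono) auto
    then show ?thesis
      using card_le_order_statistic(1)[OF j(1), of f] j by (simp add: m_def f_def)
  next
    case False
    then have "{b\<in>{1..B}. f b \<ge> m} \<subseteq> {b\<in>{1..B}. \<bar>f b - \<mu>\<bar> \<ge> \<delta>}"
      using assms(2) unfolding mom by auto
    then have "card {b\<in>{1..B}. f b \<ge> m} \<le> card {b\<in>{1..B}. \<bar>f b - \<mu>\<bar> \<ge> \<delta>}"
      by (intro card_mono) auto
    then show ?thesis
      using card_le_order_statistic(2)[OF j(1), of f] j by (simp add: m_def f_def)
  qed
qed

text \<open>Blocks occupy disjoint index intervals, and functions of disjoint groups of independent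
  variables are independent.\<close>

lemma (in prob_space) indep_vars_block_averages:
  fixes X :: "nat \<Rightarrow> 'a \<Rightarrow> real"
  assumes indep: "indep_vars (\<lambda>_. borel) X {1..}"
  shows "indep_vars (\<lambda>_. borel) (\<lambda>b \<omega>. block_average s (\<lambda>l. X l \<omega>) b) {1..B}"
proof -
  define J where "J = (\<lambda>b. {(b - 1) * s + 1..b * s})"
  have disj: "disjoint_family_on J {1..B}"
    unfolding disjoint_family_on_def
  proof (intro ballI impI)
    have lt: "J b \<inter> J c = {}" if "b < c" for b c
    proof -
      have "b * s \<le> (c - 1) * s"
        using that by (intro mult_right_mono) auto
      then show ?thesis
        by (intro equals0I) (simp only: J_def Int_iff atLeastAtMost_iff, linarith)
    qed
    fix b c :: nat assume "b \<noteq> c"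
    then show "J b \<inter> J c = {}"
      using lt[of b c] lt[of c b] by (cases "b < c") auto
  qed
  have "indep_vars (\<lambda>b. PiM (J b) (\<lambda>_. borel)) (\<lambda>b \<omega>. restrict (\<lambda>l. X l \<omega>) (J b)) {1..B}"
    by (rule indep_vars_restrict[OF indep _ disj]) (auto simp: J_def)
  then have "indep_vars (\<lambda>_. borel)
      (\<lambda>b \<omega>. (\<lambda>x. (\<Sum>l\<in>J b. x l) / real s) (restrict (\<lambda>l. X l \<omega>) (J b))) {1..B}"
    by (rule indep_vars_compose2) measurable
  then show ?thesis
    by (simp add: block_average_def J_def)
qed

text \<open>A union bound over the index sets that contain at least half of the blocks. The
  conclusion supplies a measurable superset, which spares a proof that the count, and later the
  median, is measurable.\<close>

lemma (in prob_space) half_of_indep_events_bound: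
  assumes indep: "indep_vars (\<lambda>_. borel) Y {1..B}" and "1 \<le> B"
    and A: "A \<in> sets borel"
    and small: "\<And>b. b \<in> {1..B} \<Longrightarrow> prob {\<omega>\<in>space M. Y b \<omega> \<in> A} \<le> exp (- 4)"
  shows "\<exists>E\<in>events. {\<omega>\<in>space M. B \<le> 2 * card {b\<in>{1..B}. Y b \<omega> \<in> A}} \<subseteq> E \<and> prob E \<le> exp (- real B)"
proof (intro bexI conjI)
  define F where "F = {S. S \<subseteq> {1..B} \<and> B \<le> 2 * card S}"
  define bad where "bad = (\<lambda>S. \<Inter>b\<in>S. Y b -` A \<inter> space M)"
  have "finite F"
    by (rule finite_subset[of _ "Pow {1..B}"]) (auto simp: F_def)
  have F: "finite S" "S \<noteq> {}" "S \<subseteq> {1..B}" "B \<le> 2 * card S" if "S \<in> F" for S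
    using that \<open>1 \<le> B\<close> by (auto simp: F_def intro: finite_subset)
  have rv: "random_variable borel (Y b)" if "b \<in> {1..B}" for b
    using indep that by (auto simp: indep_vars_def2)
  have ev: "bad S \<in> events" if "S \<in> F" for S
    unfolding bad_def using F[OF that] A by (intro sets.finite_INT measurable_sets[OF rv]) auto
  show "(\<Union>S\<in>F. bad S) \<in> events"
    using \<open>finite F\<close> ev by auto
  \<comment> \<open>The index set to pick for \<open>\<omega>\<close> is the set of all
    \<open>b\<close> with \<open>Y b \<omega> \<in> A\<close>.\<close>
  show "{\<omega>\<in>space M. B \<le> 2 * card {b\<in>{1..B}. Y b \<omega> \<in> A}} \<subseteq> (\<Union>S\<in>F. bad S)"
  proof
    fix \<omega> assume \<omega>: "\<omega> \<in> {\<omega>\<in>space M. B \<le> 2 * card {b\<in>{1..B}. Y b \<omega> \<in> A}}"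
    then have "{b\<in>{1..B}. Y b \<omega> \<in> A} \<in> F"
      by (auto simp: F_def)
    moreover have "\<omega> \<in> bad {b\<in>{1..B}. Y b \<omega> \<in> A}"
      using \<omega> F(2)[OF \<open>_ \<in> F\<close>] by (auto simp: bad_def)
    ultimately show "\<omega> \<in> (\<Union>S\<in>F. bad S)"
      by blast
  qed
  \<comment> \<open>By independence at least \<open>B / 2\<close> factors of size at most
    \<open>exp (- 4)\<close> are multiplied. The result leaves \<open>exp (- B)\<close> once the
    number of index sets, at most \<open>2 ^ B \<le> exp B\<close>, is paid for.\<close>
  have "prob (bad S) \<le> exp (- 2 * real B)" if "S \<in> F" for S
  proof -
    have "prob (bad S) = (\<Prod>b\<in>S. prob (Y b -` A \<inter> space M))"
      unfolding bad_def using F[OF that] A by (intro indep_varsD[OF indep]) auto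
    also have "\<dots> \<le> (\<Prod>b\<in>S. exp (- 4))"
    proof (intro prod_mono conjI)
      fix b assume "b \<in> S"
      then have "b \<in> {1..B}"
        using F[OF that] by auto
      moreover have "Y b -` A \<inter> space M = {\<omega>\<in>space M. Y b \<omega> \<in> A}"
        by auto
      ultimately show "prob (Y b -` A \<inter> space M) \<le> exp (- 4)"
        using small by simp
    qed simp
    also have "\<dots> = exp (- 4 * real (card S))"
      by (simp add: exp_of_nat_mult[symmetric] mult.commute)
    also have "\<dots> \<le> exp (- 2 * real B)"
      using F(4)[OF that] by simp
    finally show ?thesis .
  qed
  then have "(\<Sum>S\<in>F. prob (bad S)) \<le> real (card F) * exp (- 2 * real B)"
    by (rule sum_bounded_above)
  also have "\<dots> \<le> exp (real B) * exp (- 2 * real B)"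
  proof (rule mult_right_mono)
    have "card F \<le> card (Pow {1..B})"
      by (rule card_mono) (auto simp: F_def)
    then have "real (card F) \<le> 2 ^ B"
      by (simp add: card_Pow)
    also have "\<dots> \<le> exp 1 ^ B"
      using exp_ge_add_one_self[of 1] by (intro power_mono) auto
    also have "\<dots> = exp (real B)"
      by (simp add: exp_of_nat_mult[symmetric])
    finally show "real (card F) \<le> exp (real B)" .
  qed simp
  also have "\<dots> = exp (- real B)"
    by (simp flip: exp_add)
  finally show "prob (\<Union>S\<in>F. bad S) \<le> exp (- real B)"
    using finite_measure_subadditive_finite[OF \<open>finite F\<close>, of bad] ev by fastforce
qed

text \<open>\<open>s\<close> is a sample size from which the weak law bounds the failure of a single
  block by \<open>exp (- 4)\<close>, and \<open>s * B \<le> n\<close> gives each block at least that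
  length. As \<open>s\<close> is obtained before \<open>B\<close>, \<open>n\<close> and the samples,
  it can be fixed once for all horizons.\<close>

lemma (in prob_space) median_of_means_concentration:
  fixes N :: "real measure"
  assumes N: "sets N = sets borel" "integrable N (\<lambda>x. x)" and "\<delta> > 0"
  obtains s :: nat where
    "\<And>B n X. 1 \<le> B \<Longrightarrow> s * B \<le> n \<Longrightarrow> indep_vars (\<lambda>_. borel) X {1..} \<Longrightarrow>
       (\<And>l. 1 \<le> l \<Longrightarrow> distr M borel (X l) = N) \<Longrightarrow>
       \<exists>E\<in>events. {\<omega>\<in>space M. \<bar>median_of_means B n (\<lambda>l. X l \<omega>) - (\<integral>x. x \<partial>N)\<bar> \<ge> \<delta>} \<subseteq> E
         \<and> prob E \<le> exp (- real B)"
proof -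
  obtain s where s: "\<And>(A :: nat set) X. finite A \<Longrightarrow> s \<le> card A \<Longrightarrow> indep_vars (\<lambda>_. borel) X A \<Longrightarrow>
       (\<And>l. l \<in> A \<Longrightarrow> distr M borel (X l) = N) \<Longrightarrow>
       prob {\<omega>\<in>space M. \<bar>(\<Sum>l\<in>A. X l \<omega>) / card A - (\<integral>x. x \<partial>N)\<bar> \<ge> \<delta>} \<le> exp (- 4)"
    using weak_law_uniform[OF N \<open>\<delta> > 0\<close>, of "exp (- 4)"] by auto
  show thesis
  proof (rule that[of s])
    fix B n :: nat and X :: "nat \<Rightarrow> 'a \<Rightarrow> real"
    assume "1 \<le> B" "s * B \<le> n" and indep: "indep_vars (\<lambda>_. borel) X {1..}"
      and distr: "\<And>l. 1 \<le> l \<Longrightarrow> distr M borel (X l) = N"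
    have "s \<le> n div B"
      using \<open>1 \<le> B\<close> \<open>s * B \<le> n\<close> by (simp add: less_eq_div_iff_mult_less_eq)
    define avg where "avg = (\<lambda>b \<omega>. block_average (n div B) (\<lambda>l. X l \<omega>) b)"
    define A where "A = {y::real. \<bar>y - (\<integral>x. x \<partial>N)\<bar> \<ge> \<delta>}"
    have "prob {\<omega>\<in>space M. avg b \<omega> \<in> A} \<le> exp (- 4)" if "b \<in> {1..B}" for b
    proof -
      define J where "J = {(b - 1) * (n div B) + 1..b * (n div B)}"
      have "J \<subseteq> {1..}"
        by (auto simp: J_def)
      have "1 \<le> b"
        using that by simp
      \<comment> \<open>Writing \<open>b\<close> as a successor removes the truncated subtraction
        \<open>b - 1\<close> from the size of the block.\<close>
      then obtain b' where "b = Suc b'"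
        by (cases b) auto
      then have "card J = n div B"
        by (simp add: J_def)
      moreover have "prob {\<omega>\<in>space M. \<bar>(\<Sum>l\<in>J. X l \<omega>) / card J - (\<integral>x. x \<partial>N)\<bar> \<ge> \<delta>} \<le> exp (- 4)"
        using \<open>J \<subseteq> {1..}\<close> \<open>card J = n div B\<close> \<open>s \<le> n div B\<close> distr
        by (intro s indep_vars_subset[OF indep]) (auto simp: J_def)
      ultimately show ?thesis
        by (simp add: avg_def A_def block_average_def J_def)
    qed
    moreover have "indep_vars (\<lambda>_. borel) avg {1..B}"
      unfolding avg_def using indep by (rule indep_vars_block_averages)
    moreover have "A \<in> sets borel"
      unfolding A_def by measurable
    ultimately obtain E where E: "E \<in> events" "prob E \<le> exp (- real B)"
      "{\<omega>\<in>space M. B \<le> 2 * card {b\<in>{1..B}. avg b \<omega> \<in> A}} \<subseteq> E"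
      using half_of_indep_events_bound[of avg B A] \<open>1 \<le> B\<close> by blast
    have "{\<omega>\<in>space M. \<bar>median_of_means B n (\<lambda>l. X l \<omega>) - (\<integral>x. x \<partial>N)\<bar> \<ge> \<delta>} \<subseteq> E"
    proof
      fix \<omega> assume \<omega>: "\<omega> \<in> {\<omega>\<in>space M. \<bar>median_of_means B n (\<lambda>l. X l \<omega>) - (\<integral>x. x \<partial>N)\<bar> \<ge> \<delta>}"
      then have "B \<le> 2 * card {b\<in>{1..B}. avg b \<omega> \<in> A}"
        using median_of_means_deviation_imp_half_blocks[OF \<open>1 \<le> B\<close>, of \<delta> n "\<lambda>l. X l \<omega>"]
        by (simp add: avg_def A_def)
      then show "\<omega> \<in> E"
        using E(3) \<omega> by blast
    qed
    then show "\<exists>E\<in>events. {\<omega>\<in>space M. \<bar>median_of_means B n (\<lambda>l. X l \<omega>) - (\<integral>x. x \<partial>N)\<bar> \<ge> \<delta>} \<subseteq> E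
         \<and> prob E \<le> exp (- real B)"
      using E by blast
  qed
qed

subsection \<open>Regret of AdaR-ETC\<close>

text \<open>The pulls of arm \<open>i\<close> are the rounds \<open>K * j + i\<close>. Each of the
  \<open>L div K\<close> complete cycles contains one, the unfinished cycle at most one
  more.\<close>

lemma num_pulls_bounds:
  assumes "i \<in> {1..K}"
  shows "L div K \<le> num_pulls K L i" "num_pulls K L i \<le> L div K + 1"
proof -
  have "K > 0"
    using assms by auto
  let ?S = "{t \<in> {1..L}. round_robin K t = i}"
  have "inj (\<lambda>j. K * j + i)"
    using \<open>K > 0\<close> by (auto simp: inj_def)
  then have card: "card ((\<lambda>j. K * j + i) ` A) = card A" for A
    by (intro card_image) (auto intro: inj_on_subset)
  have "(\<lambda>j. K * j + i) ` {..<L div K} \<subseteq> ?S"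
  proof safe
    fix j assume "j < L div K"
    then have "K * Suc j \<le> K * (L div K)"
      by (intro mult_left_mono) auto
    also have "\<dots> \<le> L"
      by simp
    finally show "K * j + i \<in> {1..L}"
      using assms by auto
    have "(K * j + i - 1) mod K = i - 1"
    proof -
      have "K * j + i - 1 = i - 1 + K * j"
        using assms by auto
      moreover have "(i - 1 + K * j) mod K = (i - 1) mod K"
        by (rule mod_mult_self2)
      ultimately have "(K * j + i - 1) mod K = (i - 1) mod K"
        by (simp only:)
      also have "\<dots> = i - 1"
        using assms by (intro mod_less) auto
      finally show ?thesis .
    qed
    then show "round_robin K (K * j + i) = i"
      using assms by (simp add: round_robin_def)
  qed
  from card_mono[OF _ this] show "L div K \<le> num_pulls K L i"
    by (simp add: num_pulls_def card)
  have "?S \<subseteq> (\<lambda>j. K * j + i) ` {..<L div K + 1}"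
  proof
    fix t assume t: "t \<in> ?S"
    \<comment> \<open>Rounds start at 1, so the cycle that contains \<open>t\<close> has index
      \<open>(t - 1) div K\<close>.\<close>
    have "t = K * ((t - 1) div K) + i"
      using t mult_div_mod_eq[of K "t - 1"] by (auto simp: round_robin_def)
    moreover have "(t - 1) div K \<le> L div K"
      using t by (intro div_le_mono) auto
    ultimately show "t \<in> (\<lambda>j. K * j + i) ` {..<L div K + 1}"
      by auto
  qed
  from card_mono[OF _ this] show "num_pulls K L i \<le> L div K + 1"
    by (simp add: num_pulls_def card)
qed

lemma sum_round_robin:
  assumes "1 \<le> K"
  shows "(\<Sum>t = 1..L. f (round_robin K t)) = (\<Sum>i = 1..K. real (num_pulls K L i) * f i)"
proof -
  have "(\<Sum>t = 1..L. f (round_robin K t)) =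
      (\<Sum>i = 1..K. \<Sum>t\<in>{t \<in> {1..L}. round_robin K t = i}. f (round_robin K t))"
    using assms by (intro sum.group[symmetric]) (auto simp: round_robin_def Suc_le_eq)
  also have "\<dots> = (\<Sum>i = 1..K. real (num_pulls K L i) * f i)"
    by (intro sum.cong refl) (simp add: num_pulls_def)
  finally show ?thesis .
qed

lemma gap_nonneg:
  assumes "i \<in> {1..K}"
  shows "0 \<le> gap K \<nu> i"
  using assms by (simp add: gap_def best_mean_def)

lemma best_arm:
  assumes "1 \<le> K"
  obtains i where "i \<in> {1..K}" "arm_mean \<nu> i = best_mean K \<nu>"
proof -
  have "best_mean K \<nu> \<in> arm_mean \<nu> ` {1..K}"
    unfolding best_mean_def using assms by (intro Max_in) auto
  then show thesis
    using that by auto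
qed

text \<open>The bound holds pathwise before integration: exploration charges each gap at most
  \<open>L / K + 1\<close> times, and a commitment round costs nothing off \<open>E\<close> and at
  most the sum of the gaps on \<open>E\<close>. All randomness is thus reduced to the probability of
  one event.\<close>

lemma adar_etc_regret_le:
  fixes T :: nat and \<epsilon> \<alpha> q :: real
  assumes "prob_space M" "1 \<le> K" and run: "adar_etc_run M X K T \<epsilon> \<alpha> q I"
    and L: "L = exploration_length K T \<epsilon> \<alpha> q"
    and E: "E \<in> sets M"
    and good: "\<And>\<omega> i. \<omega> \<in> space M - E \<Longrightarrow> i \<in> {1..K} \<Longrightarrow>
      \<bar>median_of_means (num_blocks K T) (num_pulls K L i) (\<lambda>l. X i l \<omega>) - arm_mean \<nu> i\<bar> < \<delta>"
    and sep: "\<And>i. i \<in> {1..K} \<Longrightarrow> 0 < gap K \<nu> i \<Longrightarrow> 2 * \<delta> \<le> gap K \<nu> i"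
  shows "regret M K \<nu> T I \<le> (\<Sum>i = 1..K. gap K \<nu> i) * (real L / real K + 1 + real T * measure M E)"
proof -
  interpret prob_space M by fact
  define G where "G = (\<Sum>i = 1..K. gap K \<nu> i)"
  have "0 \<le> G"
    unfolding G_def by (intro sum_nonneg) (simp add: gap_nonneg)
  have gap_le: "gap K \<nu> i \<le> G" if "i \<in> {1..K}" for i
    unfolding G_def using that by (intro member_le_sum) (auto simp: gap_nonneg)
  have "L \<le> T"
    by (simp add: L exploration_length_def)
  note run = run[unfolded adar_etc_run_def Let_def, folded L]
  have explore: "I t \<omega> = round_robin K t" if "\<omega> \<in> space M" "t \<in> {1..L}" for \<omega> t
    using run that by blast
  have commit: "gap K \<nu> (I t \<omega>) \<le> G * indicator E \<omega>"
    if in_space: "\<omega> \<in> space M" and t: "t \<in> {L + 1..T}" for \<omega> t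
  proof -
    have "L < T"
      using that by auto
    then obtain c where argmax: "is_arg_max (\<lambda>i. median_of_means (num_blocks K T) (num_pulls K L i) (\<lambda>l. X i l \<omega>))
        (\<lambda>i. i \<in> {1..K}) c" and "I t \<omega> = c"
      using bspec[OF mp[OF conjunct2[OF conjunct2[OF run]] \<open>L < T\<close>] in_space] t by blast
    have c: "c \<in> {1..K}"
      using argmax by (simp add: is_arg_max_linorder)
    show ?thesis
    proof (cases "\<omega> \<in> E")
      case True
      then show ?thesis
        using gap_le[OF c] \<open>I t \<omega> = c\<close> by simp
    next
      case False
      then have \<omega>: "\<omega> \<in> space M - E"
        using that by simp
      obtain i where i: "i \<in> {1..K}" "arm_mean \<nu> i = best_mean K \<nu>"
        using best_arm[OF \<open>1 \<le> K\<close>] by blast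
      have le: "median_of_means (num_blocks K T) (num_pulls K L i) (\<lambda>l. X i l \<omega>)
          \<le> median_of_means (num_blocks K T) (num_pulls K L c) (\<lambda>l. X c l \<omega>)"
        using argmax i(1) by (simp add: is_arg_max_linorder)
      \<comment> \<open>The estimate of \<open>c\<close> is at least that of the optimal arm
        \<open>i\<close>, and both are off by less than \<open>\<delta>\<close>; hence the gap of
        \<open>c\<close> is below \<open>2 * \<delta>\<close>, which \<open>sep\<close> excludes for
        a positive gap.\<close>
      have "\<not> 0 < gap K \<nu> c"
      proof
        assume "0 < gap K \<nu> c"
        then have "2 * \<delta> \<le> best_mean K \<nu> - arm_mean \<nu> c"
          using sep[OF c] by (simp add: gap_def)
        then show False
          using good[OF \<omega> c] good[OF \<omega> i(1)] le i(2) by linarith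
      qed
      then show ?thesis
        using False \<open>I t \<omega> = c\<close> by simp
    qed
  qed
  have bound: "(\<Sum>t = 1..T. gap K \<nu> (I t \<omega>)) \<le> G * (real L / real K + 1) + real T * (G * indicator E \<omega>)"
    if "\<omega> \<in> space M" for \<omega>
  proof -
    have "{1..T} = {1..L} \<union> {L + 1..T}"
      using \<open>L \<le> T\<close> by auto
    moreover have "{1..L} \<inter> {L + 1..T} = {}"
      by auto
    ultimately have "(\<Sum>t = 1..T. gap K \<nu> (I t \<omega>)) =
        (\<Sum>t = 1..L. gap K \<nu> (I t \<omega>)) + (\<Sum>t = L + 1..T. gap K \<nu> (I t \<omega>))"
      by (simp only: sum.union_disjoint finite_atLeastAtMost)
    also have "(\<Sum>t = 1..L. gap K \<nu> (I t \<omega>)) = (\<Sum>t = 1..L. gap K \<nu> (round_robin K t))"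
      using explore[OF that] by (intro sum.cong) auto
    also have "\<dots> = (\<Sum>i = 1..K. real (num_pulls K L i) * gap K \<nu> i)"
      by (rule sum_round_robin[OF \<open>1 \<le> K\<close>])
    also have "\<dots> \<le> (\<Sum>i = 1..K. (real L / real K + 1) * gap K \<nu> i)"
    proof (intro sum_mono mult_right_mono)
      fix i assume i: "i \<in> {1..K}"
      have "real (num_pulls K L i) \<le> real (L div K) + 1"
        using num_pulls_bounds(2)[OF i, of L] by linarith
      also have "real (L div K) \<le> real L / real K"
        using floor_divide_of_nat_eq[of L K, where ?'a = real] by linarith
      finally show "real (num_pulls K L i) \<le> real L / real K + 1"
        by simp
    qed (simp add: gap_nonneg)
    also have "\<dots> = G * (real L / real K + 1)"
      by (simp add: G_def sum_distrib_left mult.commute)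
    also have "(\<Sum>t = L + 1..T. gap K \<nu> (I t \<omega>)) \<le> real (card {L + 1..T}) * (G * indicator E \<omega>)"
      using commit[OF that] by (intro sum_bounded_above) auto
    also have "\<dots> \<le> real T * (G * indicator E \<omega>)"
      using \<open>0 \<le> G\<close> by (intro mult_right_mono) auto
    finally show ?thesis
      by simp
  qed
  have "regret M K \<nu> T I = (\<integral>\<omega>. (\<Sum>t = 1..T. gap K \<nu> (I t \<omega>)) \<partial>M)"
    by (simp add: regret_def gap_def)
  also have "\<dots> \<le> (\<integral>\<omega>. G * (real L / real K + 1) + real T * (G * indicator E \<omega>) \<partial>M)"
  \<comment> \<open>This rule asks for integrability and nonnegativity of the upper bound only, so
    nothing has to be shown about the integrand on the left.\<close>
  proof (rule integral_mono')
    show "integrable M (\<lambda>\<omega>. G * (real L / real K + 1) + real T * (G * indicator E \<omega>))"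
      using E by (auto simp: emeasure_eq_measure)
    show "0 \<le> G * (real L / real K + 1) + real T * (G * indicator E \<omega>)" for \<omega>
      using \<open>0 \<le> G\<close> by simp
  qed (rule bound)
  also have "\<dots> = G * (real L / real K + 1) + real T * (G * measure M E)"
    using E by (simp add: prob_space emeasure_eq_measure)
  also have "\<dots> = G * (real L / real K + 1 + real T * measure M E)"
    by (simp add: algebra_simps)
  finally show ?thesis
    by (simp add: G_def)
qed

section \<open>Growth of the block count and of the exploration length\<close>

lemma num_blocks_bounds:
  assumes "1 \<le> K" "1 \<le> T"
  shows "8 * ln (real K * real T ^ 3) \<le> real (num_blocks K T)"
    and "real (num_blocks K T) \<le> 8 * ln (real K * real T ^ 3) + 1"
proof -
  have "1 \<le> real K * real T ^ 3"
    using assms mult_mono[of 1 "real K" 1 "real T ^ 3"] by simp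
  then have "0 \<le> ln (real K * real T ^ 3)"
    by simp
  then show "8 * ln (real K * real T ^ 3) \<le> real (num_blocks K T)"
    and "real (num_blocks K T) \<le> 8 * ln (real K * real T ^ 3) + 1"
    unfolding num_blocks_def by linarith+
qed

text \<open>With \<open>p = K * T ^ 3\<close> the exponential is at most \<open>1 / p\<close>, while
  \<open>T * K \<le> p\<close>. The factor \<open>K\<close> anticipates a union bound over the arms,
  the factor \<open>T\<close> the length of the commitment phase.\<close>

lemma horizon_mult_exp_num_blocks_le:
  assumes "1 \<le> K" "1 \<le> T"
  shows "real T * (real K * exp (- real (num_blocks K T))) \<le> 1"
proof -
  define p where "p = real K * real T ^ 3"
  have "1 \<le> real T ^ 2" "1 \<le> real K"
    using assms by auto
  then have TK: "real T * real K \<le> p"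
    using mult_left_mono[of 1 "real T ^ 2" "real T * real K"]
    by (simp add: p_def power3_eq_cube power2_eq_square mult_ac)
  moreover have "1 \<le> real T * real K"
    using assms mult_mono[of 1 "real T" 1 "real K"] by simp
  ultimately have "1 \<le> p"
    by simp
  then have "ln p \<le> real (num_blocks K T)"
    using num_blocks_bounds(1)[OF assms] ln_ge_zero[of p] by (simp flip: p_def)
  then have "real T * real K * exp (- real (num_blocks K T)) \<le> exp (ln p) * exp (- ln p)"
    using TK \<open>1 \<le> p\<close> by (intro mult_mono) auto
  then show ?thesis
    by (simp add: mult.assoc flip: exp_add)
qed

lemma exploration_length_div_le:
  assumes "1 \<le> K"
  shows "real (exploration_length K T \<epsilon> \<alpha> q) / real K
    \<le> real (num_blocks K T) + real K powr (q - 1) * real T powr adar_beta \<epsilon> \<alpha> + 1"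
proof -
  define x where "x = real K powr q * real T powr adar_beta \<epsilon> \<alpha>"
  have "0 \<le> x"
    by (simp add: x_def)
  have "real (exploration_length K T \<epsilon> \<alpha> q) \<le> real (K * num_blocks K T + nat \<lceil>x\<rceil>)"
    unfolding exploration_length_def x_def of_nat_le_iff by (rule min.cobounded2)
  also have "\<dots> \<le> real K * real (num_blocks K T) + (x + 1)"
    using \<open>0 \<le> x\<close> by simp
  also have "\<dots> \<le> real K * (real (num_blocks K T) + real K powr (q - 1) * real T powr adar_beta \<epsilon> \<alpha> + 1)"
    using assms by (simp add: x_def powr_diff distrib_left)
  finally show ?thesis
    using assms by (simp add: divide_le_eq mult.commute)
qed

text \<open>The term \<open>K * num_blocks K T\<close> is dropped; the minimum remains because
  exploration is cut off at \<open>T\<close>.\<close>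

lemma exploration_length_div_ge:
  assumes "1 \<le> K"
  shows "min (real T / real K) (real K powr (q - 1) * real T powr adar_beta \<epsilon> \<alpha>)
    \<le> real (exploration_length K T \<epsilon> \<alpha> q) / real K"
proof -
  define x where "x = real K powr q * real T powr adar_beta \<epsilon> \<alpha>"
  have "x \<le> real (K * num_blocks K T + nat \<lceil>x\<rceil>)"
    using real_nat_ceiling_ge[of x] by (simp add: add_increasing)
  then have "min (real T) x \<le> real (exploration_length K T \<epsilon> \<alpha> q)"
    unfolding exploration_length_def x_def[symmetric] of_nat_min by (intro min.mono) auto
  then have "min (real T) x / real K \<le> real (exploration_length K T \<epsilon> \<alpha> q) / real K"
    by (rule divide_right_mono) simp
  moreover have "real K powr (q - 1) * real T powr adar_beta \<epsilon> \<alpha> = x / real K"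
    using assms by (simp add: x_def powr_diff)
  ultimately show ?thesis
    using assms by (simp add: min_divide_distrib_right)
qed

text \<open>The block count is logarithmic in \<open>T\<close>, whereas both \<open>T / K\<close>
  and the power of \<open>T\<close> with positive exponent grow polynomially. Hence blocks
  eventually reach any prescribed length \<open>s\<close>, as the concentration bound
  demands.\<close>

lemma eventually_num_pulls_ge:
  assumes "1 \<le> K" "0 < adar_beta \<epsilon> \<alpha>"
  shows "\<forall>\<^sub>F T in sequentially. \<forall>i\<in>{1..K}.
    s * num_blocks K T \<le> num_pulls K (exploration_length K T \<epsilon> \<alpha> q) i"
proof -
  define k where "k = real K"
  define a where "a = k powr (q - 1)"
  define b where "b = adar_beta \<epsilon> \<alpha>"
  \<comment> \<open>One more than \<open>s\<close>, so that the coefficient is positive even for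
    \<open>s = 0\<close>.\<close>
  define r where "r = real s + 1"
  have "0 < k" "0 < a" "0 < b" "0 < r"
    using assms by (auto simp: k_def a_def b_def r_def)
  \<comment> \<open>The outer \<open>+ 1\<close> pays for rounding \<open>L / K\<close> down to
    \<open>L div K\<close>.\<close>
  then have "\<forall>\<^sub>F T :: nat in sequentially. r * (8 * ln (k * real T ^ 3) + 1) + 1 < real T / k"
    "\<forall>\<^sub>F T :: nat in sequentially. r * (8 * ln (k * real T ^ 3) + 1) + 1 < a * real T powr b"
    by real_asymp+
  moreover have "\<forall>\<^sub>F T :: nat in sequentially. 1 \<le> T"
    by (rule eventually_ge_at_top)
  ultimately show ?thesis
  proof eventually_elim
    case (elim T)
    define L where "L = exploration_length K T \<epsilon> \<alpha> q"
    show ?case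
    proof
      fix i assume i: "i \<in> {1..K}"
      have "real s * real (num_blocks K T) \<le> r * real (num_blocks K T)"
        by (simp add: r_def mult_right_mono)
      also have "\<dots> \<le> r * (8 * ln (k * real T ^ 3) + 1)"
        using num_blocks_bounds(2)[OF assms(1) elim(3)] by (intro mult_left_mono) (auto simp: k_def r_def)
      also have "\<dots> < min (real T / k) (a * real T powr b) - 1"
        using elim by simp
      also have "\<dots> \<le> real L / real K - 1"
        using exploration_length_div_ge[OF assms(1), of T q \<epsilon> \<alpha>] by (simp add: L_def k_def a_def b_def)
      also have "\<dots> \<le> real (L div K)"
        using floor_divide_of_nat_eq[of L K, where ?'a = real] by linarith
      also have "\<dots> \<le> real (num_pulls K L i)"
        using num_pulls_bounds(1)[OF i] by simp
      finally show "s * num_blocks K T \<le> num_pulls K (exploration_length K T \<epsilon> \<alpha> q) i"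
        unfolding L_def[symmetric] by (metis less_imp_le of_nat_le_iff of_nat_mult)
    qed
  qed
qed

section \<open>Integrability and independence of the rewards of a single arm\<close>

lemma integrable_of_finite_moment:
  fixes N :: "real measure"
  assumes "prob_space N" and sets: "sets N = sets borel" and "0 < \<epsilon>"
    and moment: "(\<integral>\<^sup>+x. ennreal (\<bar>x\<bar> powr (1 + \<epsilon>)) \<partial>N) < \<infinity>"
  shows "integrable N (\<lambda>x. x)"
proof -
  interpret prob_space N by fact
  note [measurable_cong] = sets
  have "integrable N (\<lambda>x. \<bar>x\<bar> powr (1 + \<epsilon>))"
    using moment by (intro integrableI_bounded) auto
  then have "integrable N (\<lambda>x. 1 + \<bar>x\<bar> powr (1 + \<epsilon>))"
    by (intro Bochner_Integration.integrable_add) auto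
  then show ?thesis
  proof (rule Bochner_Integration.integrable_bound)
    show "AE x in N. norm x \<le> norm (1 + \<bar>x\<bar> powr (1 + \<epsilon>))"
    proof (intro always_eventually allI)
      fix x :: real
      \<comment> \<open>The constant dominates for \<open>\<bar>x\<bar> \<le> 1\<close>, the power
        beyond; the constant is integrable because \<open>N\<close> is a probability
        measure.\<close>
      have "\<bar>x\<bar> \<le> 1 + \<bar>x\<bar> powr (1 + \<epsilon>)"
      proof (cases "\<bar>x\<bar> \<le> 1")
        case False
        then have "\<bar>x\<bar> powr 1 \<le> \<bar>x\<bar> powr (1 + \<epsilon>)"
          using \<open>0 < \<epsilon>\<close> by (intro powr_mono) auto
        then show ?thesis
          using False by simp
      qed (simp add: add_increasing2)
      then show "norm x \<le> norm (1 + \<bar>x\<bar> powr (1 + \<epsilon>))"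
        by simp
    qed
  qed measurable
qed

text \<open>The singletons \<open>{(i, l)}\<close> act as disjoint groups, which turns a family
  indexed by pairs into one indexed by \<open>l\<close>; evaluation at the only coordinate recovers
  the variable.\<close>

lemma (in prob_space) indep_vars_row:
  assumes "indep_vars (\<lambda>_. borel) (\<lambda>(i, l). X i l) (A \<times> B)" "i \<in> A"
  shows "indep_vars (\<lambda>_. borel) (X i :: 'b \<Rightarrow> 'a \<Rightarrow> real) B"
proof -
  have "indep_vars (\<lambda>l. PiM {(i, l)} (\<lambda>_. borel))
      (\<lambda>l \<omega>. restrict (\<lambda>p. (case p of (i, l) \<Rightarrow> X i l) \<omega>) {(i, l)}) B"
    using assms by (intro indep_vars_restrict) (auto simp: disjoint_family_on_def)
  then have "indep_vars (\<lambda>_. borel)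
      (\<lambda>l \<omega>. (\<lambda>x. x (i, l)) (restrict (\<lambda>p. (case p of (i, l) \<Rightarrow> X i l) \<omega>) {(i, l)})) B"
    by (rule indep_vars_compose2) (auto intro: measurable_component_singleton)
  then show ?thesis
    by simp
qed

section \<open>Asymptotic regret on a fixed instance\<close>

theorem theorem6:
  fixes M :: "'w measure" and \<nu> :: "nat \<Rightarrow> real measure"
    and X :: "nat \<Rightarrow> nat \<Rightarrow> 'w \<Rightarrow> real" and I :: "nat \<Rightarrow> nat \<Rightarrow> 'w \<Rightarrow> nat"
    and K :: nat and \<epsilon> \<alpha> q u :: real
  assumes "0 < \<epsilon>" and "\<epsilon> \<le> 1"
    and "(1 + \<epsilon>) / (1 + 2 * \<epsilon>) \<le> \<alpha>" and "\<alpha> < 1"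
    and "0 \<le> q" and "q \<le> \<epsilon> / (1 + 2 * \<epsilon>)"
    and "2 \<le> K" and "0 < u"
    and "\<nu> \<in> bounded_moment_class K \<epsilon> u"
    and "bandit_rewards M K \<nu> X"
    and "\<And>T. 1 \<le> T \<Longrightarrow> adar_etc_run M X K T \<epsilon> \<alpha> q (I T)"
  shows "limsup (\<lambda>T. ereal (regret M K \<nu> T (I T) /
                              (real K powr (q - 1) * real T powr adar_beta \<epsilon> \<alpha>)))
           \<le> ereal (\<Sum>i | i \<in> {1..K} \<and> gap K \<nu> i > 0. gap K \<nu> i)"
proof -
  interpret prob_space M
    using assms(10) by (simp add: bandit_rewards_def)
  have "1 \<le> K"
    using \<open>2 \<le> K\<close> by simp
  define G where "G = (\<Sum>i = 1..K. gap K \<nu> i)"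
  have "0 \<le> G"
    unfolding G_def by (intro sum_nonneg) (simp add: gap_nonneg)
  have G_eq: "G = (\<Sum>i | i \<in> {1..K} \<and> gap K \<nu> i > 0. gap K \<nu> i)"
    unfolding G_def by (intro sum.mono_neutral_right) (auto intro: antisym simp: gap_nonneg not_less)
  have "0 < adar_beta \<epsilon> \<alpha>"
    using \<open>0 < \<epsilon>\<close> \<open>\<alpha> < 1\<close> by (simp add: adar_beta_def)

  obtain \<delta> where "0 < \<delta>" and sep: "\<And>i. i \<in> {1..K} \<Longrightarrow> 0 < gap K \<nu> i \<Longrightarrow> 2 * \<delta> \<le> gap K \<nu> i"
  proof
    \<comment> \<open>The smallest positive gap, capped at 1; the inserted 1 keeps the set nonempty
      when all arms are optimal.\<close>
    define D where "D = Min (insert 1 (gap K \<nu> ` {i \<in> {1..K}. 0 < gap K \<nu> i}))"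
    have "0 < D"
      unfolding D_def by (subst Min_gr_iff) auto
    then show "0 < D / 2"
      by simp
    show "2 * (D / 2) \<le> gap K \<nu> i" if "i \<in> {1..K}" "0 < gap K \<nu> i" for i
      using that by (auto simp: D_def intro!: Min_le)
  qed

  have indep: "indep_vars (\<lambda>_. borel) (X i) {1..}" if "i \<in> {1..K}" for i
    using assms(10) that by (auto simp: bandit_rewards_def intro: indep_vars_row)
  have distr: "distr M borel (X i l) = \<nu> i" if "i \<in> {1..K}" "1 \<le> l" for i l
    using assms(10) that by (auto simp: bandit_rewards_def)
  have arm: "sets (\<nu> i) = sets borel" "integrable (\<nu> i) (\<lambda>x. x)" if "i \<in> {1..K}" for i
  proof -
    have \<nu>: "prob_space (\<nu> i)" "sets (\<nu> i) = sets borel"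
      "(\<integral>\<^sup>+x. ennreal (\<bar>x\<bar> powr (1 + \<epsilon>)) \<partial>\<nu> i) \<le> ennreal u"
      using assms(9) that by (auto simp: bounded_moment_class_def)
    then show "sets (\<nu> i) = sets borel"
      by simp
    have "(\<integral>\<^sup>+x. ennreal (\<bar>x\<bar> powr (1 + \<epsilon>)) \<partial>\<nu> i) < \<infinity>"
      using \<nu>(3) by (rule order.strict_trans1) simp
    with \<nu>(1,2) \<open>0 < \<epsilon>\<close> show "integrable (\<nu> i) (\<lambda>x. x)"
      by (rule integrable_of_finite_moment)
  qed

  define mom where "mom = (\<lambda>B n i \<omega>. median_of_means B n (\<lambda>l. X i l \<omega>))"
  \<comment> \<open>States that \<open>s\<close> is a valid sample threshold for arm
    \<open>i\<close>; as a predicate it lets \<open>bchoice\<close> select one threshold per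
    arm.\<close>
  define conc where "conc = (\<lambda>i s. \<forall>B n. 1 \<le> B \<longrightarrow> s * B \<le> n \<longrightarrow>
      (\<exists>E\<in>events. {\<omega>\<in>space M. \<bar>mom B n i \<omega> - arm_mean \<nu> i\<bar> \<ge> \<delta>} \<subseteq> E \<and> prob E \<le> exp (- real B)))"
  have "\<exists>s. conc i s" if i: "i \<in> {1..K}" for i
  proof (rule median_of_means_concentration[OF arm[OF i] \<open>0 < \<delta>\<close>])
    fix s assume "\<And>B n X. 1 \<le> B \<Longrightarrow> s * B \<le> n \<Longrightarrow> indep_vars (\<lambda>_. borel) X {1..} \<Longrightarrow>
       (\<And>l. 1 \<le> l \<Longrightarrow> distr M borel (X l) = \<nu> i) \<Longrightarrow>
       \<exists>E\<in>events. {\<omega>\<in>space M. \<bar>median_of_means B n (\<lambda>l. X l \<omega>) - (\<integral>x. x \<partial>\<nu> i)\<bar> \<ge> \<delta>} \<subseteq> E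
         \<and> prob E \<le> exp (- real B)"
    from this[OF _ _ indep[OF i] distr[OF i]] show ?thesis
      unfolding conc_def mom_def arm_mean_def by blast
  qed
  then obtain s where "\<forall>i\<in>{1..K}. conc i (s i)"
    using bchoice[of "{1..K}" conc] by blast
  then have s: "\<exists>E\<in>events. {\<omega>\<in>space M. \<bar>mom B n i \<omega> - arm_mean \<nu> i\<bar> \<ge> \<delta>} \<subseteq> E \<and> prob E \<le> exp (- real B)"
    if "i \<in> {1..K}" "1 \<le> B" "s i * B \<le> n" for i B n
    using that unfolding conc_def by blast
  \<comment> \<open>The arms are finitely many, so one threshold serves them all.\<close>
  define s\<^sub>0 where "s\<^sub>0 = Max (s ` {1..K})"
  have s_le: "s i \<le> s\<^sub>0" if "i \<in> {1..K}" for i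
    using that by (simp add: s\<^sub>0_def)

  define k a b where "k = real K" and "a = k powr (q - 1)" and "b = adar_beta \<epsilon> \<alpha>"
  have pos: "0 < k" "0 < a" "0 < b"
    using \<open>1 \<le> K\<close> \<open>0 < adar_beta \<epsilon> \<alpha>\<close> by (auto simp: k_def a_def b_def)
  \<comment> \<open>The constant 4 collects four units: the ceiling in the block count, the ceiling
    in the exploration length, the unfinished round-robin cycle, and the expected cost of a wrong
    commitment.\<close>
  have "\<forall>\<^sub>F T in sequentially. regret M K \<nu> T (I T) / (a * real T powr b)
      \<le> G * (1 + (8 * ln (k * real T ^ 3) + 4) / (a * real T powr b))"
    using eventually_num_pulls_ge[OF \<open>1 \<le> K\<close> \<open>0 < adar_beta \<epsilon> \<alpha>\<close>, of s\<^sub>0 q] eventually_ge_at_top[of 1]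
  proof eventually_elim
    case (elim T)
    define L where "L = exploration_length K T \<epsilon> \<alpha> q"
    define B where "B = num_blocks K T"
    have "1 \<le> B"
    proof -
      \<comment> \<open>\<open>K \<ge> 2\<close> makes the logarithm positive even at
        \<open>T = 1\<close>, so there is at least one block.\<close>
      have "1 < real K * real T ^ 3"
        using \<open>2 \<le> K\<close> elim(2) mult_mono[of 2 "real K" 1 "real T ^ 3"] by simp
      then have "0 < real B"
        using num_blocks_bounds(1)[OF \<open>1 \<le> K\<close> elim(2)] ln_gt_zero[of "real K * real T ^ 3"]
        unfolding B_def by linarith
      then show ?thesis
        by simp
    qed
    have "\<exists>E\<in>events. {\<omega>\<in>space M. \<bar>mom B (num_pulls K L i) i \<omega> - arm_mean \<nu> i\<bar> \<ge> \<delta>} \<subseteq> E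
        \<and> prob E \<le> exp (- real B)" if i: "i \<in> {1..K}" for i
    proof (rule s[OF i \<open>1 \<le> B\<close>])
      have "s i * B \<le> s\<^sub>0 * B"
        using s_le[OF i] by simp
      also have "\<dots> \<le> num_pulls K L i"
        using elim(1) i by (simp add: B_def L_def)
      finally show "s i * B \<le> num_pulls K L i" .
    qed
    then have "\<forall>i\<in>{1..K}. \<exists>E. E \<in> events \<and> {\<omega>\<in>space M. \<bar>mom B (num_pulls K L i) i \<omega> - arm_mean \<nu> i\<bar> \<ge> \<delta>} \<subseteq> E
        \<and> prob E \<le> exp (- real B)"
      by blast
    from bchoice[OF this] obtain E where E: "\<And>i. i \<in> {1..K} \<Longrightarrow> E i \<in> events"
      "\<And>i. i \<in> {1..K} \<Longrightarrow> {\<omega>\<in>space M. \<bar>mom B (num_pulls K L i) i \<omega> - arm_mean \<nu> i\<bar> \<ge> \<delta>} \<subseteq> E i"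
      "\<And>i. i \<in> {1..K} \<Longrightarrow> prob (E i) \<le> exp (- real B)"
      by blast
    \<comment> \<open>Some arm is badly estimated. The union bound costs a factor \<open>K\<close>,
      which the \<open>K\<close> inside the logarithm of the block count absorbs.\<close>
    define bad where "bad = (\<Union>i\<in>{1..K}. E i)"
    have "bad \<in> events"
      using E(1) by (auto simp: bad_def)
    have "prob bad \<le> (\<Sum>i\<in>{1..K}. prob (E i))"
      unfolding bad_def using E(1) by (intro finite_measure_subadditive_finite) auto
    also have "\<dots> \<le> real (card {1..K}) * exp (- real B)"
      using E(3) by (intro sum_bounded_above) auto
    finally have "real T * prob bad \<le> real T * (real K * exp (- real B))"
      by (intro mult_left_mono) auto
    then have few_errors: "real T * prob bad \<le> 1"
      using horizon_mult_exp_num_blocks_le[OF \<open>1 \<le> K\<close> elim(2)] by (simp add: B_def)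
    have "regret M K \<nu> T (I T) \<le> G * (real L / real K + 1 + real T * prob bad)"
      unfolding G_def
    proof (rule adar_etc_regret_le[OF prob_space_axioms \<open>1 \<le> K\<close> assms(11)[OF elim(2)] L_def \<open>bad \<in> events\<close> _ sep])
      fix \<omega> i assume "\<omega> \<in> space M - bad" "i \<in> {1..K}"
      then show "\<bar>median_of_means (num_blocks K T) (num_pulls K L i) (\<lambda>l. X i l \<omega>) - arm_mean \<nu> i\<bar> < \<delta>"
        using E(2)[of i] unfolding bad_def mom_def B_def by fastforce
    qed
    also have "\<dots> \<le> G * (a * real T powr b + (8 * ln (k * real T ^ 3) + 4))"
      using few_errors exploration_length_div_le[OF \<open>1 \<le> K\<close>, of T \<epsilon> \<alpha> q]
        num_blocks_bounds(2)[OF \<open>1 \<le> K\<close> elim(2)] \<open>0 \<le> G\<close>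
      by (intro mult_left_mono) (auto simp: L_def a_def b_def k_def)
    finally have "regret M K \<nu> T (I T) / (a * real T powr b)
        \<le> G * (a * real T powr b + (8 * ln (k * real T ^ 3) + 4)) / (a * real T powr b)"
      using pos by (intro divide_right_mono) auto
    also have "\<dots> = G * (1 + (8 * ln (k * real T ^ 3) + 4) / (a * real T powr b))"
      using pos elim(2) by (simp add: field_simps)
    finally show ?case .
  qed
  then have "limsup (\<lambda>T. ereal (regret M K \<nu> T (I T) / (a * real T powr b)))
      \<le> limsup (\<lambda>T. ereal (G * (1 + (8 * ln (k * real T ^ 3) + 4) / (a * real T powr b))))"
    by (intro Limsup_mono) (simp add: eventually_mono)
  also have "\<dots> = ereal G"
  proof (rule lim_imp_Limsup)
    \<comment> \<open>A logarithm divided by a power with positive exponent \<open>b\<close> tends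
      to 0, so only the main exploration term survives.\<close>
    have "(\<lambda>T::nat. (8 * ln (k * real T ^ 3) + 4) / (a * real T powr b)) \<longlonglongrightarrow> 0"
      using pos by real_asymp
    then have "(\<lambda>T::nat. G * (1 + (8 * ln (k * real T ^ 3) + 4) / (a * real T powr b))) \<longlonglongrightarrow> G * (1 + 0)"
      by (intro tendsto_intros)
    then show "(\<lambda>T. ereal (G * (1 + (8 * ln (k * real T ^ 3) + 4) / (a * real T powr b)))) \<longlonglongrightarrow> ereal G"
      by simp
  qed simp
  finally show ?thesis
    by (simp add: G_eq a_def b_def k_def)
qed

end
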